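(* Let $\kappa\colon[0,1]^2\to[0,1]$ be a graphon (measurable and symmetric) that is continuous and satisfies $$\int_{[0,1]}\kappa(x,y)\,dy>0\qquad\forall\,x\in[0,1].$$ For all $n\ge1$, let $\Delta^T_{[n]}$ be the triangle friendship-bias of the random graph $G(n,\kappa)$. Then $$\lim_{n\to\infty}n^{-2}\Delta^T_{[n]}=\chi^T\qquad\mathbb P\text{-almost surely},$$ with $$\chi^T=\int_{[0,1]}dx\left[\frac1{\mathcal D(x)}\int_{[0,1]}dy\,\kappa(x,y)\,\mathcal T(y)-\mathcal T(x)\right],$$ where $$\mathcal D(x)=\int_{[0,1]}dy\,\kappa(x,y),\qquad \mathcal T(x)=\tfrac12\int_{[0,1]^2}dy\,dz\,\kappa(x,y)\kappa(y,z)\kappa(z,x)$$ denote the degree density, respectively the triangle density, at $x\in[0,1]$.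
   Context: $G(n,\kappa)$ is the (simple) random graph with vertex set $[n]=\{1,\dots,n\}$ in which distinct vertices $i=\lceil xn\rceil$ and $j=\lceil yn\rceil$ are connected by an edge, independently over pairs, with probability $\kappa(x,y)$; concretely, with probability $\kappa(i/n,j/n)$. The graphs $G(n,\kappa)$, $n\ge1$, are defined on a common probability space with probability $\mathbb P$. Triangle friendship-bias. For a finite graph on $[n]$ with adjacency matrix $(A_{ij})$, degrees $d_i=\sum_jA_{ij}$, and $t_i$ the number of triangles containing $i$, $$\Delta^T_{i,n}=\Big[\frac1{d_i}\sum_{j\in[n]}A_{ij}t_j-t_i\Big]\mathbf 1_{\{d_i\ne0\}},\qquad \Delta^T_{[n]}=\frac1n\sum_{i\in[n]}\Delta^T_{i,n}.$$ *)

theory Defs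
  imports "HOL-Probability.Probability"
begin

text \<open>A simple graph on \<open>V\<close> is given by its adjacency relation.\<close>

definition simple_graph_on :: "'v set \<Rightarrow> ('v \<Rightarrow> 'v \<Rightarrow> bool) \<Rightarrow> bool" where
  "simple_graph_on V E \<longleftrightarrow>
     (\<forall>i j. E i j \<longrightarrow> i \<in> V \<and> j \<in> V) \<and> (\<forall>i j. E i j \<longrightarrow> E j i) \<and> (\<forall>i. \<not> E i i)"

definition adj :: "('v \<Rightarrow> 'v \<Rightarrow> bool) \<Rightarrow> 'v \<Rightarrow> 'v \<Rightarrow> real" where
  "adj E i j = (if E i j then 1 else 0)"

definition vertex_degree :: "nat \<Rightarrow> (nat \<Rightarrow> nat \<Rightarrow> bool) \<Rightarrow> nat \<Rightarrow> real" where
  "vertex_degree n E i = (\<Sum>j\<in>{1..n}. adj E i j)"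

text \<open>Triangles are unordered, so each is counted once as a three-element vertex set.\<close>

definition triangles :: "nat \<Rightarrow> (nat \<Rightarrow> nat \<Rightarrow> bool) \<Rightarrow> nat set set" where
  "triangles n E = {S. S \<subseteq> {1..n} \<and> card S = 3 \<and> (\<forall>i\<in>S. \<forall>j\<in>S. i \<noteq> j \<longrightarrow> E i j)}"

definition triangle_count :: "nat \<Rightarrow> (nat \<Rightarrow> nat \<Rightarrow> bool) \<Rightarrow> nat \<Rightarrow> nat" where
  "triangle_count n E i = card {S \<in> triangles n E. i \<in> S}"

definition vertex_triangle_bias :: "nat \<Rightarrow> (nat \<Rightarrow> nat \<Rightarrow> bool) \<Rightarrow> nat \<Rightarrow> real" where
  "vertex_triangle_bias n E i =
     (if vertex_degree n E i \<noteq> 0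
      then 1 / vertex_degree n E i * (\<Sum>j\<in>{1..n}. adj E i j * real (triangle_count n E j))
             - real (triangle_count n E i)
      else 0)"

definition triangle_bias :: "nat \<Rightarrow> (nat \<Rightarrow> nat \<Rightarrow> bool) \<Rightarrow> real" where
  "triangle_bias n E = 1 / real n * (\<Sum>i\<in>{1..n}. vertex_triangle_bias n E i)"

text \<open>Only the values of \<open>\<kappa>\<close> on the unit square are constrained.\<close>

definition graphon :: "(real \<Rightarrow> real \<Rightarrow> real) \<Rightarrow> bool" where
  "graphon \<kappa> \<longleftrightarrow>
     (\<lambda>(x, y). \<kappa> x y) \<in> borel_measurable (restrict_space borel ({0..1} \<times> {0..1})) \<and>
     (\<forall>x\<in>{0..1}. \<forall>y\<in>{0..1}. \<kappa> x y \<in> {0..1} \<and> \<kappa> x y = \<kappa> y x)"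

text \<open>
  Independence is over unordered pairs of distinct vertices, each represented by its increasing
  ordering; it includes measurability of the edge indicators.
\<close>

definition graphon_random_graph ::
    "'a measure \<Rightarrow> nat \<Rightarrow> (real \<Rightarrow> real \<Rightarrow> real) \<Rightarrow> ('a \<Rightarrow> nat \<Rightarrow> nat \<Rightarrow> bool) \<Rightarrow> bool" where
  "graphon_random_graph M n \<kappa> G \<longleftrightarrow>
     (\<forall>\<omega>\<in>space M. simple_graph_on {1..n} (G \<omega>)) \<and>
     prob_space.indep_vars M (\<lambda>_. count_space UNIV) (\<lambda>(i, j) \<omega>. G \<omega> i j)
       {(i, j). 1 \<le> i \<and> i < j \<and> j \<le> n} \<and>
     (\<forall>i j. 1 \<le> i \<and> i < j \<and> j \<le> n \<longrightarrow>
        measure M {\<omega> \<in> space M. G \<omega> i j} = \<kappa> (real i / real n) (real j / real n))"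

definition degree_density :: "(real \<Rightarrow> real \<Rightarrow> real) \<Rightarrow> real \<Rightarrow> real" where
  "degree_density \<kappa> x = (LINT y:{0..1}|lborel. \<kappa> x y)"

definition triangle_density :: "(real \<Rightarrow> real \<Rightarrow> real) \<Rightarrow> real \<Rightarrow> real" where
  "triangle_density \<kappa> x =
     1 / 2 * (LINT p:{0..1} \<times> {0..1}|lborel. \<kappa> x (fst p) * \<kappa> (fst p) (snd p) * \<kappa> (snd p) x)"

definition triangle_chi :: "(real \<Rightarrow> real \<Rightarrow> real) \<Rightarrow> real" where
  "triangle_chi \<kappa> =
     (LINT x:{0..1}|lborel.
        1 / degree_density \<kappa> x * (LINT y:{0..1}|lborel. \<kappa> x y * triangle_density \<kappa> y)
        - triangle_density \<kappa> x)"

end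

theory Submission
  imports Defs "HOL-Real_Asymp.Real_Asymp"
begin

text \<open>
  Give vertex \<open>i\<close> the position \<open>x = i / n\<close>. The claim holds because, almost surely, every local statistic that
  enters the bias is close to its density at \<open>x\<close>, uniformly over all vertices of the \<open>n\<close>-th graph. Then the
  rescaled bias is close to a Riemann sum of the continuous integrand defining \<open>triangle_chi\<close>.

  Triangle counts are not sums of independent terms, and conditioning on the neighbourhood of a vertex
  would be cumbersome. Instead they are built up in two stages, each of which only sums
  independent terms. First, the codegree of two distinct vertices \<open>k\<close> and \<open>i\<close> is a sum over \<open>j\<close> of products
  over disjoint pairs of edges, hence concentrates for all pairs simultaneously (\<open>codegrees\<close>).
  Secondly, the number \<open>t\<^sub>i\<close> of triangles at \<open>i\<close> is half the sum of the codegrees of \<open>k\<close> and \<open>i\<close> over the neighbours \<open>k\<close> of \<open>i\<close>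
  (\<open>triangle_count_eq\<close>). Once the codegrees are replaced by their deterministic limits, this is a linear
  expression in the edges at \<open>i\<close>, which concentrates as well (\<open>averages_over_neighbours\<close>). The sum of the
  \<open>t\<^sub>j\<close> over the neighbours \<open>j\<close> of \<open>i\<close> is treated in the same way.

  Both concentration statements are instances of \<open>averages_of_disjoint_products\<close>: Hoeffding's
  inequality gives a bound that is exponentially small in \<open>n\<close>, which survives a union bound over
  \<open>n\<^sup>2\<close> index pairs and a Borel--Cantelli argument. The passage from these finitely many almost sure
  limits to the limit of the bias is deterministic (\<open>bias_of_convergent_graphs\<close>). Its one delicate step is
  the division by the degree: continuity and compactness bound the degree density below by a
  positive constant, so eventually no vertex is isolated and the quotients converge uniformly.
\<close>

section \<open>Averages and limits that are uniform over vertices\<close>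

definition vertex_avg :: "nat \<Rightarrow> (nat \<Rightarrow> real) \<Rightarrow> real" where
  "vertex_avg n f = (\<Sum>j\<in>{1..n}. f j) / real n"

lemma vertex_avg_diff: "vertex_avg n (\<lambda>j. f j - g j) = vertex_avg n f - vertex_avg n g"
  by (simp add: vertex_avg_def sum_subtractf diff_divide_distrib)

lemma abs_vertex_avg_le:
  assumes "\<And>j. j \<in> {1..n} \<Longrightarrow> \<bar>f j\<bar> \<le> e" and "0 \<le> e"
  shows "\<bar>vertex_avg n f\<bar> \<le> e"
proof (cases "n = 0")
  case False
  have "\<bar>\<Sum>j\<in>{1..n}. f j\<bar> \<le> (\<Sum>j\<in>{1..n}. \<bar>f j\<bar>)" by (rule sum_abs)
  also have "\<dots> \<le> real n * e"
    using sum_bounded_above[of "{1..n}" "\<lambda>j. \<bar>f j\<bar>" e] assms by simp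
  finally show ?thesis using False by (simp add: vertex_avg_def field_simps)
qed (use assms in \<open>simp add: vertex_avg_def\<close>)

text \<open>
  Most limits below are uniform over an index set that grows with \<open>n\<close>: over the vertices, or over
  the pairs of distinct vertices. Convergence to \<open>0\<close> along the following filter on pairs
  \<open>(n, s)\<close> with \<open>s \<in> S n\<close> is exactly such a uniform limit, so that the
  ordinary rules for sums, products and transformations of limits apply to it.
\<close>

definition uniformly_along :: "(nat \<Rightarrow> 's set) \<Rightarrow> (nat \<times> 's) filter" where
  "uniformly_along S = inf (filtercomap fst sequentially) (principal (SIGMA n:UNIV. S n))"

lemma eventually_uniformly_along:
  "eventually P (uniformly_along S) \<longleftrightarrow> (\<forall>\<^sub>F n in sequentially. \<forall>s\<in>S n. P (n, s))"
proof -
  have "eventually P (uniformly_along S) \<longleftrightarrow>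
      (\<exists>Q. eventually Q sequentially \<and> (\<forall>x. Q (fst x) \<longrightarrow> x \<in> (SIGMA n:UNIV. S n) \<longrightarrow> P x))"
    by (simp add: uniformly_along_def eventually_inf_principal eventually_filtercomap)
  also have "\<dots> \<longleftrightarrow> (\<forall>\<^sub>F n in sequentially. \<forall>s\<in>S n. P (n, s))"
    by (auto elim!: eventually_mono)
  finally show ?thesis .
qed

lemma tendsto_0_uniformly_along:
  fixes f :: "nat \<times> 's \<Rightarrow> real"
  shows "(f \<longlongrightarrow> 0) (uniformly_along S) \<longleftrightarrow>
    (\<forall>e>0. \<forall>\<^sub>F n in sequentially. \<forall>s\<in>S n. \<bar>f (n, s)\<bar> < e)"
  by (simp add: tendsto_iff eventually_uniformly_along)

abbreviation vertices :: "(nat \<times> nat) filter" where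
  "vertices \<equiv> uniformly_along (\<lambda>n. {1..n})"

text \<open>
  Stated with differences because, along \<open>vertices\<close>, the comparison values \<open>a\<close> and \<open>b\<close>
  depend on the vertex and do not converge themselves. The lower bound on \<open>b\<close> forces \<open>g \<ge> \<delta> / 2\<close>
  eventually, where the quotient is Lipschitz in numerator and denominator.
\<close>

lemma tendsto_0_diff_quotient:
  fixes f g a b :: "'x \<Rightarrow> real"
  assumes f: "((\<lambda>x. f x - a x) \<longlongrightarrow> 0) F" and g: "((\<lambda>x. g x - b x) \<longlongrightarrow> 0) F"
    and a: "eventually (\<lambda>x. \<bar>a x\<bar> \<le> C) F" and b: "eventually (\<lambda>x. \<delta> \<le> b x) F" and "0 < \<delta>"
  shows "((\<lambda>x. f x / g x - a x / b x) \<longlongrightarrow> 0) F"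
proof (rule Lim_null_comparison)
  have "eventually (\<lambda>x. \<bar>g x - b x\<bar> < \<delta> / 2) F"
    using tendstoD[OF g, of "\<delta> / 2"] \<open>0 < \<delta>\<close> by simp
  then show "eventually (\<lambda>x. norm (f x / g x - a x / b x)
      \<le> 2 / \<delta> * (\<bar>f x - a x\<bar> + C / \<delta> * \<bar>g x - b x\<bar>)) F"
    using a b
  proof eventually_elim
    case (elim x)
    have gx: "g x \<ge> \<delta> / 2" and bx: "b x \<ge> \<delta>"
      using elim unfolding abs_less_iff by linarith+
    have pos: "g x > 0" "b x > 0" using gx bx \<open>0 < \<delta>\<close> by auto
    have "f x / g x - a x / b x = ((f x - a x) - a x / b x * (g x - b x)) / g x"
      using pos by (simp add: field_simps)
    also have "\<bar>\<dots>\<bar> \<le> (\<bar>f x - a x\<bar> + \<bar>a x / b x\<bar> * \<bar>g x - b x\<bar>) / g x"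
      using abs_triangle_ineq4[of "f x - a x" "a x / b x * (g x - b x)"] pos
      by (auto simp: abs_mult intro!: divide_right_mono)
    also have "\<dots> \<le> (\<bar>f x - a x\<bar> + C / \<delta> * \<bar>g x - b x\<bar>) / (\<delta> / 2)"
    proof -
      have "\<bar>a x / b x\<bar> \<le> C / \<delta>"
        using elim pos bx \<open>0 < \<delta>\<close> by (auto simp: abs_div intro!: frac_le)
      moreover from this have "0 \<le> C / \<delta>" by (rule order_trans[OF abs_ge_zero])
      ultimately show ?thesis using gx \<open>0 < \<delta>\<close> pos
        by (intro frac_le add_mono mult_right_mono add_nonneg_nonneg mult_nonneg_nonneg) auto
    qed
    finally show ?case by (simp add: mult.commute)
  qed
  show "((\<lambda>x. 2 / \<delta> * (\<bar>f x - a x\<bar> + C / \<delta> * \<bar>g x - b x\<bar>)) \<longlongrightarrow> 0) F"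
    using tendsto_rabs_zero[OF f] tendsto_rabs_zero[OF g]
    by (intro tendsto_mult_right_zero tendsto_add_zero)
qed

lemma vertex_avg_tendsto_0:
  assumes "(f \<longlongrightarrow> 0) vertices"
  shows "(\<lambda>n. vertex_avg n (\<lambda>i. f (n, i))) \<longlonglongrightarrow> 0"
proof (rule tendstoI)
  fix e :: real assume "0 < e"
  then have "\<forall>\<^sub>F n in sequentially. \<forall>i\<in>{1..n}. \<bar>f (n, i)\<bar> < e / 2"
    using assms half_gt_zero unfolding tendsto_0_uniformly_along by blast
  then show "\<forall>\<^sub>F n in sequentially. dist (vertex_avg n (\<lambda>i. f (n, i))) 0 < e"
  proof eventually_elim
    case (elim n)
    have "\<bar>vertex_avg n (\<lambda>i. f (n, i))\<bar> \<le> e / 2"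
      using elim \<open>0 < e\<close> by (intro abs_vertex_avg_le) (auto intro: less_imp_le)
    then show ?case using \<open>0 < e\<close> by simp
  qed
qed

section \<open>Riemann sums of a continuous family\<close>

text \<open>
  On each cell of length \<open>1 / n\<close> the integrand differs by at most \<open>e\<close> from its value at the right
  endpoint. Summing over the cells is an induction on the number \<open>m\<close> of cells, with the error
  bounded by \<open>e\<close> times the length \<open>m / n\<close> of the interval already covered.
\<close>

lemma riemann_sum_error:
  fixes f :: "real \<Rightarrow> real"
  assumes cont: "continuous_on {0..1} f" and n: "0 < n" and e: "0 \<le> e"
    and osc: "\<And>y z. y \<in> {0..1} \<Longrightarrow> z \<in> {0..1} \<Longrightarrow> \<bar>y - z\<bar> \<le> 1 / real n \<Longrightarrow> \<bar>f y - f z\<bar> \<le> e"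
  shows "\<bar>vertex_avg n (\<lambda>j. f (real j / real n)) - integral {0..1} f\<bar> \<le> e"
proof -
  have "\<bar>(\<Sum>j\<in>{1..m}. f (real j / real n)) / real n - integral {0..real m / real n} f\<bar>
      \<le> e * (real m / real n)" if "m \<le> n" for m
    using that
  proof (induction m)
    case 0
    then show ?case by simp
  next
    case (Suc m)
    let ?a = "real m / real n" and ?b = "real (Suc m) / real n"
    have ab: "0 \<le> ?a" "?a \<le> ?b" "?b \<le> 1" and len: "?b - ?a = 1 / real n"
      using Suc.prems n by (simp_all add: divide_right_mono flip: diff_divide_distrib)
    have int: "f integrable_on {0..?b}" "f integrable_on {?a..?b}"
      using ab by (auto intro!: integrable_continuous_real continuous_on_subset[OF cont] intro: order_trans[OF ab(1)])
    have split: "integral {0..?b} f = integral {0..?a} f + integral {?a..?b} f"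
      using Henstock_Kurzweil_Integration.integral_combine[OF ab(1,2) int(1)] by simp
    have "((\<lambda>y. f ?b - f y) has_integral (1 / real n * f ?b - integral {?a..?b} f)) (cbox ?a ?b)"
      using has_integral_diff[OF has_integral_const_real[of "f ?b" ?a ?b] integrable_integral[OF int(2)]]
        ab(2) len by simp
    then have "norm (1 / real n * f ?b - integral {?a..?b} f) \<le> e * measure lborel (cbox ?a ?b)"
    proof (rule has_integral_bound[OF e])
      fix y assume "y \<in> cbox ?a ?b"
      then have "?a \<le> y" "y \<le> ?b" by auto
      then have "y \<in> {0..1}" "\<bar>?b - y\<bar> \<le> 1 / real n" "?b \<in> {0..1}"
        unfolding len[symmetric] using ab order_trans[OF ab(1)] by (simp_all del: of_nat_Suc)
      then show "norm (f ?b - f y) \<le> e" unfolding real_norm_def by (intro osc)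
    qed
    then have "\<bar>1 / real n * f ?b - integral {?a..?b} f\<bar> \<le> e * (1 / real n)"
      using ab len by simp
    moreover have "(\<Sum>j\<in>{1..Suc m}. f (real j / real n)) / real n
        = (\<Sum>j\<in>{1..m}. f (real j / real n)) / real n + 1 / real n * f ?b"
      by (simp add: add_divide_distrib)
    moreover have "e * ?b = e * ?a + e * (1 / real n)"
      using n by (simp add: field_simps)
    moreover have "\<bar>(\<Sum>j\<in>{1..m}. f (real j / real n)) / real n - integral {0..?a} f\<bar> \<le> e * ?a"
      using Suc by simp
    ultimately show ?case using split by linarith
  qed
  from this[of n] n show ?thesis by (simp add: vertex_avg_def)
qed

abbreviation unit_square :: "(real \<times> real) set" where
  "unit_square \<equiv> {0..1} \<times> {0..1}"

text \<open>
  The oscillation over a cell is controlled by uniform continuity on the compact product of \<open>C\<close> with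
  the unit interval, hence simultaneously for all parameters. The parameters will be positions of a
  vertex or of a pair of vertices.
\<close>

lemma riemann_sums_uniform:
  fixes F :: "'p::metric_space \<Rightarrow> real \<Rightarrow> real"
  assumes C: "compact C" and cont: "continuous_on (C \<times> {0..1}) (\<lambda>(p, y). F p y)" and e: "0 < e"
  shows "\<forall>\<^sub>F n in sequentially. \<forall>p\<in>C.
    \<bar>vertex_avg n (\<lambda>j. F p (real j / real n)) - integral {0..1} (F p)\<bar> < e"
proof -
  have "uniformly_continuous_on (C \<times> {0..1}) (\<lambda>(p, y). F p y)"
    using cont C by (intro compact_uniformly_continuous compact_Times) auto
  then obtain d where d: "0 < d" and
    F: "\<And>u v. u \<in> C \<times> {0..1} \<Longrightarrow> v \<in> C \<times> {0..1} \<Longrightarrow> dist v u < d \<Longrightarrow>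
      dist ((\<lambda>(p, y). F p y) v) ((\<lambda>(p, y). F p y) u) < e / 2"
    using e unfolding uniformly_continuous_on_def by (meson half_gt_zero)
  have "(\<lambda>n. 1 / real n) \<longlonglongrightarrow> 0" by real_asymp
  then have "\<forall>\<^sub>F n in sequentially. 1 / real n < d"
    using d by (rule order_tendstoD)
  then show ?thesis using eventually_gt_at_top[of 0]
  proof eventually_elim
    case (elim n)
    show ?case
    proof
      fix p assume p: "p \<in> C"
      have "continuous_on {0..1} (\<lambda>y. (\<lambda>(p, y). F p y) (p, y))"
        using p by (intro continuous_on_compose2[OF cont] continuous_intros) auto
      then have "\<bar>vertex_avg n (\<lambda>j. F p (real j / real n)) - integral {0..1} (F p)\<bar> \<le> e / 2"
      proof (intro riemann_sum_error)
        fix y z :: real assume "y \<in> {0..1}" "z \<in> {0..1}" "\<bar>y - z\<bar> \<le> 1 / real n"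
        then show "\<bar>F p y - F p z\<bar> \<le> e / 2"
          using F[of "(p, z)" "(p, y)"] p elim by (auto simp: dist_Pair_Pair dist_real_def)
      qed (use elim e in auto)
      then show "\<bar>vertex_avg n (\<lambda>j. F p (real j / real n)) - integral {0..1} (F p)\<bar> < e"
        using e by simp
    qed
  qed
qed

section \<open>Counting triangles\<close>

text \<open>
  A triangle \<open>{i, j, k}\<close> through \<open>i\<close> corresponds to the two ordered pairs \<open>(j, k)\<close> and \<open>(k, j)\<close>, and
  simplicity of the graph rules out nonzero terms with coinciding vertices. The inner sum is the number of
  common neighbours of \<open>k\<close> and \<open>i\<close>; this grouping is what makes triangle counts accessible to
  concentration of sums of independent terms.
\<close>

lemma triangle_count_eq:
  assumes E: "simple_graph_on {1..n} E" and i: "i \<in> {1..n}"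
  shows "real (triangle_count n E i)
    = 1 / 2 * (\<Sum>k\<in>{1..n}. adj E i k * (\<Sum>j\<in>{1..n}. adj E k j * adj E j i))"
proof -
  have sym: "E a b \<Longrightarrow> E b a" and irr: "\<not> E a a" and dom: "E a b \<Longrightarrow> a \<in> {1..n}" for a b
    using E unfolding simple_graph_on_def by blast+
  define P where "P = {(j, k). E i k \<and> E k j \<and> E j i}"
  define Tr where "Tr = {S \<in> triangles n E. i \<in> S}"
  have P_sub: "P \<subseteq> {1..n} \<times> {1..n}"
    unfolding P_def using dom by blast
  then have finP: "finite P" by (rule finite_subset) simp
  have finTr: "finite Tr"
    unfolding Tr_def triangles_def by (rule finite_subset[of _ "Pow {1..n}"]) auto
  have fibre: "card {p \<in> P. {i, fst p, snd p} = S} = 2" if S: "S \<in> Tr" for S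
  proof -
    have "card (S - {i}) = 2" using S unfolding Tr_def triangles_def by simp
    then obtain a b where ab: "S - {i} = {a, b}" "a \<noteq> b" by (auto simp: card_2_iff)
    then have Sab: "S = {i, a, b}" and ne: "a \<noteq> i" "b \<noteq> i" using S unfolding Tr_def by blast+
    have "E x y" if "x \<in> S" "y \<in> S" "x \<noteq> y" for x y
      using S that unfolding Tr_def triangles_def by blast
    then have "E i a" "E a b" "E b i" using Sab ne ab(2) by auto
    then have "(a, b) \<in> P" "(b, a) \<in> P" unfolding P_def using sym by auto
    moreover have "p \<in> {(a, b), (b, a)}" if "p \<in> P" "{i, fst p, snd p} = S" for p
    proof -
      obtain j k where p: "p = (j, k)" by (cases p)
      have "j \<noteq> i" "k \<noteq> i" "j \<noteq> k" using that(1) irr unfolding p P_def by auto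
      moreover have "j \<in> {i, a, b}" "k \<in> {i, a, b}" using that(2) unfolding p Sab by auto
      ultimately show ?thesis unfolding p by blast
    qed
    moreover have "{i, a, b} = S" "{i, b, a} = S" using Sab by auto
    ultimately have "{p \<in> P. {i, fst p, snd p} = S} = {(a, b), (b, a)}" by auto
    then show ?thesis using ab(2) by simp
  qed
  have into: "{i, fst p, snd p} \<in> Tr" if "p \<in> P" for p
  proof -
    obtain j k where p: "p = (j, k)" by (cases p)
    have e: "E i k" "E k j" "E j i" using that unfolding P_def p by auto
    then have "i \<noteq> k" "k \<noteq> j" "j \<noteq> i" using irr by auto
    then show ?thesis
      unfolding Tr_def triangles_def p using e sym dom by auto
  qed
  have "card P = (\<Sum>S\<in>Tr. card {p \<in> P. {i, fst p, snd p} = S})"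
    using sum.group[OF finP finTr, of "\<lambda>p. {i, fst p, snd p}" "\<lambda>_. 1::nat"] into
    by (auto simp: image_subset_iff)
  also have "\<dots> = 2 * card Tr" using fibre by simp
  finally have two: "card P = 2 * triangle_count n E i"
    by (simp add: Tr_def triangle_count_def)
  have "(\<Sum>k\<in>{1..n}. adj E i k * (\<Sum>j\<in>{1..n}. adj E k j * adj E j i))
      = (\<Sum>j\<in>{1..n}. \<Sum>k\<in>{1..n}. adj E i k * (adj E k j * adj E j i))"
    unfolding sum_distrib_left by (rule sum.swap)
  also have "\<dots> = (\<Sum>p\<in>{1..n} \<times> {1..n}. of_bool (p \<in> P))"
    unfolding sum.cartesian_product by (intro sum.cong refl) (clarsimp simp: adj_def P_def)
  also have "\<dots> = real (card P)"
    using P_sub by (simp add: Int_absorb1 flip: Int_def)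
  finally show ?thesis using two by simp
qed

section \<open>Concentration of averages of disjoint edge products\<close>

text \<open>
  Products over disjoint sets of independent events are again independent, with mean the product
  of the probabilities; Hoeffding's inequality then applies to their weighted sum.
\<close>

lemma (in prob_space) disjoint_products_deviation:
  fixes B :: "'e \<Rightarrow> 'a \<Rightarrow> bool" and K :: "'j \<Rightarrow> 'e set" and c :: "'j \<Rightarrow> real"
  assumes indep: "indep_vars (\<lambda>_. count_space UNIV) B E"
    and J: "finite J" "card J \<le> n" and K: "\<And>j. j \<in> J \<Longrightarrow> finite (K j) \<and> K j \<subseteq> E"
    and disj: "disjoint_family_on K J"
    and c: "\<And>j. j \<in> J \<Longrightarrow> c j \<in> {0..1}" and t: "0 < t" and n: "0 < n"
  shows "prob {\<omega> \<in> space M. t * real n \<le>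
      \<bar>(\<Sum>j\<in>J. c j * (\<Prod>e\<in>K j. of_bool (B e \<omega>)))
        - (\<Sum>j\<in>J. c j * (\<Prod>e\<in>K j. prob {\<omega> \<in> space M. B e \<omega>}))\<bar>}
    \<le> 2 * exp (- 2 * t\<^sup>2 * real n)"
proof (cases "J = {}")
  case True
  have "\<not> t * real n \<le> 0" using t n by (simp add: not_le)
  with True show ?thesis by simp
next
  case False
  define X where "X j \<omega> = c j * (\<Prod>e\<in>K j. of_bool (B e \<omega>) :: real)" for j \<omega>
  have "indep_vars (\<lambda>_. borel)
      (\<lambda>j \<omega>. (\<lambda>x. c j * (\<Prod>e\<in>K j. of_bool (x e))) (restrict (\<lambda>e. B e \<omega>) (K j))) J"
  proof (rule indep_vars_compose2[OF indep_vars_restrict[OF indep _ disj]])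
    fix j assume "j \<in> J"
    have [measurable]: "(\<lambda>x. of_bool (x e) :: real)
        \<in> borel_measurable (PiM (K j) (\<lambda>_. count_space UNIV))" if "e \<in> K j" for e
    proof -
      have "(\<lambda>b. of_bool b :: real) \<in> count_space UNIV \<rightarrow>\<^sub>M borel" by simp
      from measurable_compose[OF measurable_component_singleton[OF that] this] show ?thesis .
    qed
    show "(\<lambda>x. c j * (\<Prod>e\<in>K j. of_bool (x e)))
        \<in> borel_measurable (PiM (K j) (\<lambda>_. count_space UNIV))"
      by (intro borel_measurable_times borel_measurable_const borel_measurable_prod) auto
  qed (use K in auto)
  also have "(\<lambda>j \<omega>. (\<lambda>x. c j * (\<Prod>e\<in>K j. of_bool (x e))) (restrict (\<lambda>e. B e \<omega>) (K j))) = X"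
    by (auto simp: X_def fun_eq_iff intro!: prod.cong)
  finally have X: "indep_vars (\<lambda>_. borel) X J" .
  have range: "X j \<omega> \<in> {0..1}" if "j \<in> J" for j \<omega>
  proof -
    have "(\<Prod>e\<in>K j. of_bool (B e \<omega>) :: real) \<in> {0..1}"
      by (auto intro!: prod_nonneg prod_le_1)
    then show ?thesis using c[OF that] by (auto simp: X_def intro: mult_le_one)
  qed
  have mean: "expectation (X j) = c j * (\<Prod>e\<in>K j. prob {\<omega> \<in> space M. B e \<omega>})" if j: "j \<in> J" for j
  proof -
    have ind: "indep_vars (\<lambda>_. borel) (\<lambda>e \<omega>. of_bool (B e \<omega>) :: real) (K j)"
      by (rule indep_vars_compose2[OF indep_vars_subset[OF indep]]) (use K j in auto)
    have B: "{\<omega> \<in> space M. B e \<omega>} \<in> events" if "e \<in> K j" for e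
    proof -
      have "B e \<in> M \<rightarrow>\<^sub>M count_space UNIV"
        using indep K j that unfolding indep_vars_def by blast
      from measurable_sets[OF this, of "{True}"] show ?thesis
        by (simp add: vimage_def Int_def conj_commute)
    qed
    have int: "integrable M (\<lambda>\<omega>. of_bool (B e \<omega>) :: real)"
      "expectation (\<lambda>\<omega>. of_bool (B e \<omega>)) = prob {\<omega> \<in> space M. B e \<omega>}" if "e \<in> K j" for e
    proof -
      have eq: "of_bool (B e \<omega>) = (indicator {\<omega> \<in> space M. B e \<omega>} \<omega> :: real)" if "\<omega> \<in> space M" for \<omega>
        using that by (simp add: indicator_def)
      show "integrable M (\<lambda>\<omega>. of_bool (B e \<omega>) :: real)"
        using B[OF that] by (subst Bochner_Integration.integrable_cong[OF refl eq])
          (auto intro!: integrable_real_indicator simp: less_top[symmetric])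
      show "expectation (\<lambda>\<omega>. of_bool (B e \<omega>)) = prob {\<omega> \<in> space M. B e \<omega>}"
        using B[OF that] by (subst Bochner_Integration.integral_cong[OF refl eq]) (auto simp: Int_absorb2)
    qed
    have "expectation (\<lambda>\<omega>. \<Prod>e\<in>K j. of_bool (B e \<omega>) :: real)
        = (\<Prod>e\<in>K j. prob {\<omega> \<in> space M. B e \<omega>})"
      using indep_vars_lebesgue_integral[OF _ ind] K j int by (simp cong: prod.cong)
    then show ?thesis by (simp add: X_def[abs_def])
  qed
  interpret Hoeffding_ineq M J X "\<lambda>_. 0" "\<lambda>_. 1" "\<Sum>j\<in>J. expectation (X j)"
    by unfold_locales (use J X range in auto)
  have card: "0 < card J" using J False by (simp add: card_gt_0_iff)
  have "prob {\<omega> \<in> space M. t * real n \<le> \<bar>(\<Sum>j\<in>J. X j \<omega>) - (\<Sum>j\<in>J. expectation (X j))\<bar>}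
      \<le> 2 * exp (- 2 * (t * real n)\<^sup>2 / real (card J))"
    using Hoeffding_ineq_abs_ge[of "t * real n"] t n card by simp
  also have "\<dots> \<le> 2 * exp (- 2 * t\<^sup>2 * real n)"
  proof -
    have "t\<^sup>2 * real n * real (card J) \<le> t\<^sup>2 * real n * real n"
      using J by (intro mult_left_mono) auto
    then have "t\<^sup>2 * real n \<le> (t * real n)\<^sup>2 / real (card J)"
      using card by (simp add: field_simps power2_eq_square)
    then show ?thesis by simp
  qed
  finally show ?thesis using mean by (simp add: X_def)
qed

text \<open>
  A union bound over the at most \<open>n\<^sup>2\<close> indices leaves a summable bound, so Borel--Cantelli
  applies for each threshold; the thresholds \<open>1 / (k + 1)\<close> suffice for the limit.
\<close>

lemma (in prob_space) AE_tendsto_0_of_exponential_tails: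
  fixes Z :: "nat \<Rightarrow> 's \<Rightarrow> 'a \<Rightarrow> real" and S :: "nat \<Rightarrow> 's set"
  assumes S: "\<And>n. finite (S n) \<and> card (S n) \<le> n\<^sup>2"
    and meas: "\<And>n s. s \<in> S n \<Longrightarrow> random_variable borel (Z n s)"
    and tail: "\<And>n s t. 0 < t \<Longrightarrow> 0 < n \<Longrightarrow> s \<in> S n \<Longrightarrow>
      prob {\<omega> \<in> space M. t \<le> \<bar>Z n s \<omega>\<bar>} \<le> 2 * exp (- 2 * t\<^sup>2 * real n)"
  shows "AE \<omega> in M. ((\<lambda>(n, s). Z n s \<omega>) \<longlongrightarrow> 0) (uniformly_along S)"
proof -
  have small: "AE \<omega> in M. \<forall>\<^sub>F n in sequentially. \<forall>s\<in>S n. \<bar>Z n s \<omega>\<bar> < t" if t: "0 < t" for t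
  proof -
    define A where "A n = (\<Union>s\<in>S n. {\<omega> \<in> space M. t \<le> \<bar>Z n s \<omega>\<bar>})" for n
    have ev: "{\<omega> \<in> space M. t \<le> \<bar>Z n s \<omega>\<bar>} \<in> events" if "s \<in> S n" for n s
      using meas[OF that] by measurable
    then have A: "A n \<in> events" for n
      unfolding A_def using S by (intro sets.finite_UN) auto
    have bound: "prob (A n) \<le> (real n)\<^sup>2 * (2 * exp (- 2 * t\<^sup>2 * real n))" for n
    proof (cases "n = 0")
      case True
      then have "S n = {}" using S[of n] by auto
      then show ?thesis by (simp add: A_def)
    next
      case False
      have "prob (A n) \<le> (\<Sum>s\<in>S n. prob {\<omega> \<in> space M. t \<le> \<bar>Z n s \<omega>\<bar>})"
        unfolding A_def using S ev by (intro finite_measure_subadditive_finite) auto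
      also have "\<dots> \<le> real (card (S n)) * (2 * exp (- 2 * t\<^sup>2 * real n))"
        using tail[OF t _] False by (intro sum_bounded_above) auto
      also have "\<dots> \<le> (real n)\<^sup>2 * (2 * exp (- 2 * t\<^sup>2 * real n))"
        using S[of n] by (intro mult_right_mono) (auto simp flip: of_nat_power)
      finally show ?thesis .
    qed
    have "summable (\<lambda>n. (real n)\<^sup>2 * (2 * exp (- 2 * t\<^sup>2 * real n)))"
    proof (rule summable_comparison_test_bigo)
      show "summable (\<lambda>n. norm (1 / (real n)\<^sup>2))"
        using inverse_power_summable[of 2, where 'a = real] by (simp add: field_simps)
      show "(\<lambda>n. (real n)\<^sup>2 * (2 * exp (- 2 * t\<^sup>2 * real n))) \<in> O(\<lambda>n. 1 / (real n)\<^sup>2)"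
        using t by real_asymp
    qed
    then have "summable (\<lambda>n. prob (A n))"
      by (rule summable_comparison_test') (use bound in auto)
    then have "AE \<omega> in M. \<forall>\<^sub>F n in sequentially. \<omega> \<in> space M - A n"
      using A by (intro borel_cantelli_AE1) (auto simp: less_top[symmetric])
    then show ?thesis
      by eventually_elim (auto simp: A_def not_le elim!: eventually_mono)
  qed
  then have "AE \<omega> in M. \<forall>k. \<forall>\<^sub>F n in sequentially. \<forall>s\<in>S n. \<bar>Z n s \<omega>\<bar> < 1 / real (Suc k)"
    unfolding AE_all_countable by simp
  then show ?thesis
  proof eventually_elim
    case (elim \<omega>)
    show ?case
      unfolding tendsto_0_uniformly_along
    proof (intro allI impI)
      fix e :: real assume "0 < e"
      then obtain k where k: "1 / real (Suc k) < e" using nat_approx_posE by blast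
      have "\<forall>\<^sub>F n in sequentially. \<forall>s\<in>S n. \<bar>Z n s \<omega>\<bar> < 1 / real (Suc k)" using elim ..
      then show "\<forall>\<^sub>F n in sequentially. \<forall>s\<in>S n. \<bar>case (n, s) of (n, s) \<Rightarrow> Z n s \<omega>\<bar> < e"
        by eventually_elim (use k in force)
    qed
  qed
qed

text \<open>
  The almost sure input for everything that follows. The averages run over all vertices \<open>j\<close>, but
  the product form of the summand \<open>Y n s j\<close> is needed only off at most two exceptional vertices: in the
  applications \<open>s\<close> is a vertex or a pair of vertices, and \<open>j\<close> may coincide with one of them, where there is
  no edge. Exceptional summands differ from \<open>m n s j\<close> by at most \<open>1\<close> and contribute at most \<open>2 / n\<close>.
\<close>

lemma (in prob_space) averages_of_disjoint_products:
  fixes B :: "nat \<Rightarrow> 'e \<Rightarrow> 'a \<Rightarrow> bool" and S :: "nat \<Rightarrow> 's set"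
    and J :: "nat \<Rightarrow> 's \<Rightarrow> nat set" and K :: "nat \<Rightarrow> 's \<Rightarrow> nat \<Rightarrow> 'e set"
    and Y :: "nat \<Rightarrow> 's \<Rightarrow> nat \<Rightarrow> 'a \<Rightarrow> real" and c m :: "nat \<Rightarrow> 's \<Rightarrow> nat \<Rightarrow> real"
  assumes indep: "\<And>n. 0 < n \<Longrightarrow> indep_vars (\<lambda>_. count_space UNIV) (B n) (E n)"
    and S: "\<And>n. finite (S n) \<and> card (S n) \<le> n\<^sup>2"
    and J: "\<And>n s. s \<in> S n \<Longrightarrow> J n s \<subseteq> {1..n} \<and> card ({1..n} - J n s) \<le> 2"
    and K: "\<And>n s j. s \<in> S n \<Longrightarrow> j \<in> J n s \<Longrightarrow> finite (K n s j) \<and> K n s j \<subseteq> E n"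
    and disj: "\<And>n s. s \<in> S n \<Longrightarrow> disjoint_family_on (K n s) (J n s)"
    and c: "\<And>n s j. s \<in> S n \<Longrightarrow> j \<in> J n s \<Longrightarrow> c n s j \<in> {0..1}"
    and Y01: "\<And>n s j \<omega>. s \<in> S n \<Longrightarrow> j \<in> {1..n} \<Longrightarrow> \<omega> \<in> space M \<Longrightarrow> Y n s j \<omega> \<in> {0..1}"
    and m01: "\<And>n s j. s \<in> S n \<Longrightarrow> j \<in> {1..n} \<Longrightarrow> m n s j \<in> {0..1}"
    and Y: "\<And>n s j \<omega>. s \<in> S n \<Longrightarrow> j \<in> J n s \<Longrightarrow> \<omega> \<in> space M \<Longrightarrow>
      Y n s j \<omega> = c n s j * (\<Prod>e\<in>K n s j. of_bool (B n e \<omega>))"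
    and m: "\<And>n s j. s \<in> S n \<Longrightarrow> j \<in> J n s \<Longrightarrow>
      m n s j = c n s j * (\<Prod>e\<in>K n s j. prob {\<omega> \<in> space M. B n e \<omega>})"
  shows "AE \<omega> in M. ((\<lambda>(n, s). vertex_avg n (\<lambda>j. Y n s j \<omega>) - vertex_avg n (m n s)) \<longlongrightarrow> 0)
    (uniformly_along S)"
proof -
  define X where "X n s \<omega> = (\<Sum>j\<in>J n s. c n s j * (\<Prod>e\<in>K n s j. of_bool (B n e \<omega>)))
    - (\<Sum>j\<in>J n s. c n s j * (\<Prod>e\<in>K n s j. prob {\<omega> \<in> space M. B n e \<omega>}))" for n s \<omega>
  have "AE \<omega> in M. ((\<lambda>(n, s). X n s \<omega> / real n) \<longlongrightarrow> 0) (uniformly_along S)"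
  proof (rule AE_tendsto_0_of_exponential_tails[OF S])
    fix n s assume s: "s \<in> S n"
    have n: "0 < n" using s S[of n] by (cases "n = 0") auto
    have "(\<lambda>\<omega>. of_bool (B n e \<omega>) :: real) \<in> borel_measurable M" if "j \<in> J n s" "e \<in> K n s j" for j e
    proof -
      have "B n e \<in> M \<rightarrow>\<^sub>M count_space UNIV"
        using indep[OF n] K[OF s that(1)] that(2) unfolding indep_vars_def by blast
      moreover have "(\<lambda>b. of_bool b :: real) \<in> count_space UNIV \<rightarrow>\<^sub>M borel" by simp
      ultimately show ?thesis by (rule measurable_compose)
    qed
    then show "random_variable borel (\<lambda>\<omega>. X n s \<omega> / real n)"
      unfolding X_def
      by (intro borel_measurable_divide borel_measurable_diff borel_measurable_sum
          borel_measurable_times borel_measurable_const borel_measurable_prod) auto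
  next
    fix n s and t :: real assume t: "0 < t" and n: "0 < n" and s: "s \<in> S n"
    have "finite (J n s)" "card (J n s) \<le> n"
      using J[OF s] finite_subset[of "J n s" "{1..n}"] card_mono[of "{1..n}" "J n s"] by auto
    then have "prob {\<omega> \<in> space M. t * real n \<le> \<bar>X n s \<omega>\<bar>} \<le> 2 * exp (- 2 * t\<^sup>2 * real n)"
      unfolding X_def using K[OF s] c[OF s] t n
      by (intro disjoint_products_deviation[OF indep[OF n] _ _ _ disj[OF s]]) auto
    also have "{\<omega> \<in> space M. t * real n \<le> \<bar>X n s \<omega>\<bar>} = {\<omega> \<in> space M. t \<le> \<bar>X n s \<omega> / real n\<bar>}"
      using n by (simp add: field_simps)
    finally show "prob {\<omega> \<in> space M. t \<le> \<bar>X n s \<omega> / real n\<bar>} \<le> 2 * exp (- 2 * t\<^sup>2 * real n)" .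
  qed
  then show ?thesis using AE_space
  proof eventually_elim
    case (elim \<omega>)
    have err: "\<bar>vertex_avg n (\<lambda>j. Y n s j \<omega>) - vertex_avg n (m n s) - X n s \<omega> / real n\<bar> \<le> 2 / real n"
      if s: "s \<in> S n" for n s
    proof -
      have split: "(\<Sum>j\<in>{1..n}. Y n s j \<omega> - m n s j)
          = (\<Sum>j\<in>{1..n} - J n s. Y n s j \<omega> - m n s j) + (\<Sum>j\<in>J n s. Y n s j \<omega> - m n s j)"
        using J[OF s] by (intro sum.subset_diff) auto
      also have "(\<Sum>j\<in>J n s. Y n s j \<omega> - m n s j) = X n s \<omega>"
        unfolding X_def sum_subtractf using Y[OF s _ elim(2)] m[OF s] by simp
      finally have "vertex_avg n (\<lambda>j. Y n s j \<omega>) - vertex_avg n (m n s) - X n s \<omega> / real n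
          = (\<Sum>j\<in>{1..n} - J n s. Y n s j \<omega> - m n s j) / real n"
        by (simp add: vertex_avg_def sum_subtractf flip: diff_divide_distrib)
      moreover have "\<bar>\<Sum>j\<in>{1..n} - J n s. Y n s j \<omega> - m n s j\<bar> \<le> 2"
      proof -
        have "\<bar>Y n s j \<omega> - m n s j\<bar> \<le> 1" if "j \<in> {1..n}" for j
          using Y01[OF s that elim(2)] m01[OF s that] by (auto simp: abs_le_iff)
        then have "(\<Sum>j\<in>{1..n} - J n s. \<bar>Y n s j \<omega> - m n s j\<bar>) \<le> real (card ({1..n} - J n s)) * 1"
          by (intro sum_bounded_above) auto
        also have "\<dots> \<le> 2" using J[OF s] by simp
        finally show ?thesis by (rule order_trans[OF sum_abs])
      qed
      ultimately show ?thesis by (simp add: divide_right_mono)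
    qed
    have lim: "((\<lambda>(n, s). X n s \<omega> / real n) \<longlongrightarrow> 0) (uniformly_along S)" by (fact elim(1))
    show ?case
      unfolding tendsto_0_uniformly_along
    proof (intro allI impI)
      fix e :: real assume e: "0 < e"
      have "\<forall>\<^sub>F n in sequentially. \<forall>s\<in>S n. \<bar>X n s \<omega> / real n\<bar> < e / 2"
        using lim[unfolded tendsto_0_uniformly_along, rule_format, OF half_gt_zero[OF e]]
        by (simp only: prod.case)
      moreover have "(\<lambda>n. 2 / real n) \<longlonglongrightarrow> 0" by real_asymp
      then have "\<forall>\<^sub>F n in sequentially. 2 / real n < e / 2"
        using half_gt_zero[OF e] by (rule order_tendstoD)
      ultimately show "\<forall>\<^sub>F n in sequentially. \<forall>s\<in>S n. \<bar>case (n, s) of (n, s) \<Rightarrow>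
          vertex_avg n (\<lambda>j. Y n s j \<omega>) - vertex_avg n (m n s)\<bar> < e"
      proof eventually_elim
        case (elim n)
        show ?case
        proof
          fix s assume s: "s \<in> S n"
          have "\<bar>X n s \<omega> / real n\<bar> < e / 2" using elim(1) s by blast
          with err[OF s] elim(2)
          have "\<bar>vertex_avg n (\<lambda>j. Y n s j \<omega>) - vertex_avg n (m n s)\<bar> < e" by linarith
          then show "\<bar>case (n, s) of (n, s) \<Rightarrow>
              vertex_avg n (\<lambda>j. Y n s j \<omega>) - vertex_avg n (m n s)\<bar> < e" by simp
        qed
      qed
    qed
  qed
qed

section \<open>Densities of a continuous graphon\<close>

locale continuous_graphon =
  fixes \<kappa> :: "real \<Rightarrow> real \<Rightarrow> real"
  assumes graphon: "graphon \<kappa>"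
    and cont: "continuous_on unit_square (\<lambda>(x, y). \<kappa> x y)"
begin

text \<open>
  The limiting proportion of common neighbours of vertices at positions \<open>x\<close> and \<open>y\<close>.
\<close>

definition codensity :: "real \<Rightarrow> real \<Rightarrow> real" where
  "codensity x y = integral {0..1} (\<lambda>z. \<kappa> x z * \<kappa> z y)"

definition neighbour_triangle_density :: "real \<Rightarrow> real" where
  "neighbour_triangle_density x = integral {0..1} (\<lambda>y. \<kappa> x y * triangle_density \<kappa> y)"

lemma graphon_in_unit: "x \<in> {0..1} \<Longrightarrow> y \<in> {0..1} \<Longrightarrow> \<kappa> x y \<in> {0..1}"
  and graphon_sym: "x \<in> {0..1} \<Longrightarrow> y \<in> {0..1} \<Longrightarrow> \<kappa> x y = \<kappa> y x"
  using graphon unfolding graphon_def by auto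

lemma continuous_on_graphon_comp [continuous_intros]:
  assumes "continuous_on S f" "continuous_on S g"
    and "\<And>s. s \<in> S \<Longrightarrow> f s \<in> {0..1}" "\<And>s. s \<in> S \<Longrightarrow> g s \<in> {0..1}"
  shows "continuous_on S (\<lambda>s. \<kappa> (f s) (g s))"
proof -
  have "continuous_on S (\<lambda>s. (\<lambda>(x, y). \<kappa> x y) (f s, g s))"
    using assms(3,4) by (intro continuous_on_compose2[OF cont] continuous_intros assms(1,2)) auto
  then show ?thesis by simp
qed

lemma continuous_on_integral_unit:
  fixes f :: "'p::topological_space \<Rightarrow> real \<Rightarrow> real"
  assumes "continuous_on (U \<times> {0..1}) (\<lambda>(p, y). f p y)"
  shows "continuous_on U (\<lambda>p. integral {0..1} (f p))"
  using integral_continuous_on_param[of U 0 1 f] assms by simp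

lemma integral_unit_in_unit:
  fixes f :: "real \<Rightarrow> real"
  assumes "continuous_on {0..1} f" "\<And>y. y \<in> {0..1} \<Longrightarrow> f y \<in> {0..1}"
  shows "integral {0..1} f \<in> {0..1}"
proof -
  have f: "f integrable_on {0..1}" using assms(1) by (rule integrable_continuous_real)
  have one: "(\<lambda>_. 1::real) integrable_on {0..1::real}" by (rule integrable_continuous_real) simp
  have "0 \<le> integral {0..1} f"
    using assms(2) by (intro Henstock_Kurzweil_Integration.integral_nonneg f) auto
  moreover have "integral {0..1} f \<le> integral {0..1::real} (\<lambda>_. 1)"
    using assms(2) by (intro Henstock_Kurzweil_Integration.integral_le f one) auto
  ultimately show ?thesis by simp
qed

text \<open>
  All integrands are continuous, so the Lebesgue integrals in the definitions of the densities can
  be traded for Henstock--Kurzweil integrals, for which continuity in parameters and Fubini on boxes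
  follow from joint continuity.
\<close>

lemma set_lebesgue_integral_unit:
  fixes f :: "real \<Rightarrow> real"
  assumes "continuous_on {0..1} f"
  shows "(LINT y:{0..1}|lborel. f y) = integral {0..1} f"
  by (rule set_borel_integral_eq_integral(2)[OF borel_integrable_atLeastAtMost'[OF assms]])

lemma codensity_cont: "continuous_on unit_square (\<lambda>(x, y). codensity x y)"
  unfolding codensity_def case_prod_unfold
  by (intro continuous_on_integral_unit, unfold case_prod_unfold, intro continuous_intros) auto

lemma codensity_in_unit: "x \<in> {0..1} \<Longrightarrow> y \<in> {0..1} \<Longrightarrow> codensity x y \<in> {0..1}"
  unfolding codensity_def
  using graphon_in_unit by (intro integral_unit_in_unit continuous_intros) (auto intro: mult_le_one)

lemma continuous_on_codensity_comp [continuous_intros]: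
  assumes "continuous_on S f" "continuous_on S g"
    and "\<And>s. s \<in> S \<Longrightarrow> f s \<in> {0..1}" "\<And>s. s \<in> S \<Longrightarrow> g s \<in> {0..1}"
  shows "continuous_on S (\<lambda>s. codensity (f s) (g s))"
proof -
  have "continuous_on S (\<lambda>s. (\<lambda>(x, y). codensity x y) (f s, g s))"
    using assms(3,4)
    by (intro continuous_on_compose2[OF codensity_cont] continuous_intros assms(1,2)) auto
  then show ?thesis by simp
qed

lemma degree_density_eq: "x \<in> {0..1} \<Longrightarrow> degree_density \<kappa> x = integral {0..1} (\<kappa> x)"
  unfolding degree_density_def
  by (intro set_lebesgue_integral_unit continuous_intros) auto

lemma degree_density_cont: "continuous_on {0..1} (degree_density \<kappa>)"
proof -
  have "continuous_on {0..1} (\<lambda>x. integral {0..1} (\<kappa> x))"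
    by (intro continuous_on_integral_unit cont)
  then show ?thesis by (rule continuous_on_eq) (simp add: degree_density_eq)
qed

text \<open>
  Fubini: integrating out one corner first exhibits the triangle density as half the integral of
  the codensity against \<open>\<kappa> x\<close>, matching the grouping in \<open>triangle_count_eq\<close>.
\<close>

lemma triangle_density_eq:
  assumes x: "x \<in> {0..1}"
  shows "triangle_density \<kappa> x = 1 / 2 * integral {0..1} (\<lambda>y. \<kappa> x y * codensity y x)"
proof -
  let ?f = "\<lambda>p. \<kappa> x (fst p) * \<kappa> (fst p) (snd p) * \<kappa> (snd p) x"
  have box: "unit_square = cbox (0, 0) (1, 1)" by (auto simp: cbox_Pair_eq)
  have f: "continuous_on unit_square ?f"
    using x by (intro continuous_intros) auto
  have "set_integrable lborel unit_square ?f"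
    unfolding set_integrable_def by (intro borel_integrable_compact compact_Times f) auto
  from set_borel_integral_eq_integral(2)[OF this]
  have "(LINT p:unit_square|lborel. ?f p) = integral (cbox (0, 0) (1, 1)) ?f"
    unfolding box .
  also have "\<dots> = integral (cbox 0 1) (\<lambda>y. integral (cbox 0 1) (\<lambda>z. ?f (y, z)))"
    using f unfolding box by (rule integral_prod_continuous)
  also have "\<dots> = integral {0..1} (\<lambda>y. \<kappa> x y * codensity y x)"
    by (simp add: codensity_def mult.assoc)
  finally show ?thesis by (simp add: triangle_density_def)
qed

lemma triangle_density_cont: "continuous_on {0..1} (triangle_density \<kappa>)"
proof -
  have "continuous_on {0..1} (\<lambda>x. 1 / 2 * integral {0..1} (\<lambda>y. \<kappa> x y * codensity y x))"
    by (intro continuous_intros continuous_on_integral_unit, unfold case_prod_unfold,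
        intro continuous_intros) auto
  then show ?thesis by (rule continuous_on_eq) (simp add: triangle_density_eq)
qed

lemma continuous_on_triangle_density_comp [continuous_intros]:
  assumes "continuous_on S f" and "\<And>s. s \<in> S \<Longrightarrow> f s \<in> {0..1}"
  shows "continuous_on S (\<lambda>s. triangle_density \<kappa> (f s))"
  using assms by (intro continuous_on_compose2[OF triangle_density_cont]) auto

lemma triangle_density_in_unit:
  assumes x: "x \<in> {0..1}"
  shows "triangle_density \<kappa> x \<in> {0..1}"
proof -
  have "integral {0..1} (\<lambda>y. \<kappa> x y * codensity y x) \<in> {0..1}"
    using x graphon_in_unit codensity_in_unit
    by (intro integral_unit_in_unit continuous_intros) (auto intro: mult_le_one)
  then show ?thesis using triangle_density_eq[OF x] by auto
qed

lemma neighbour_triangle_density_cont: "continuous_on {0..1} neighbour_triangle_density"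
  unfolding neighbour_triangle_density_def
  by (intro continuous_on_integral_unit, unfold case_prod_unfold, intro continuous_intros) auto

lemma neighbour_triangle_density_in_unit:
  assumes x: "x \<in> {0..1}"
  shows "neighbour_triangle_density x \<in> {0..1}"
  unfolding neighbour_triangle_density_def
  using x graphon_in_unit triangle_density_in_unit
  by (intro integral_unit_in_unit continuous_intros) (auto intro: mult_le_one)

lemma triangle_chi_eq:
  assumes pos: "\<And>x. x \<in> {0..1} \<Longrightarrow> 0 < degree_density \<kappa> x"
  shows "triangle_chi \<kappa> = integral {0..1}
    (\<lambda>x. neighbour_triangle_density x / degree_density \<kappa> x - triangle_density \<kappa> x)"
proof -
  have S: "(LINT y:{0..1}|lborel. \<kappa> x y * triangle_density \<kappa> y) = neighbour_triangle_density x"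
    if "x \<in> {0..1}" for x
    unfolding neighbour_triangle_density_def using that
    by (intro set_lebesgue_integral_unit continuous_intros) auto
  have "triangle_chi \<kappa> = (LINT x:{0..1}|lborel.
      neighbour_triangle_density x / degree_density \<kappa> x - triangle_density \<kappa> x)"
    unfolding triangle_chi_def by (intro set_lebesgue_integral_cong) (auto simp: S)
  also have "\<dots> = integral {0..1}
      (\<lambda>x. neighbour_triangle_density x / degree_density \<kappa> x - triangle_density \<kappa> x)"
    using pos by (intro set_lebesgue_integral_unit continuous_intros neighbour_triangle_density_cont
        degree_density_cont triangle_density_cont) (auto simp: less_le)
  finally show ?thesis .
qed

section \<open>The deterministic limit theorem\<close>

text \<open>
  Codegrees are controlled only for pairs of distinct vertices. This is enough for averages over
  the neighbours of \<open>i\<close>, because \<open>i\<close> is not its own neighbour.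
\<close>

lemma neighbour_average_tendsto_0:
  fixes h :: "nat \<times> nat \<times> nat \<Rightarrow> real"
  assumes E: "\<And>n. 0 < n \<Longrightarrow> simple_graph_on {1..n} (E n)"
    and h: "(h \<longlongrightarrow> 0) (uniformly_along (\<lambda>n. {(k, i). k \<in> {1..n} \<and> i \<in> {1..n} \<and> k \<noteq> i}))"
  shows "((\<lambda>(n, i). vertex_avg n (\<lambda>k. adj (E n) i k * h (n, k, i))) \<longlongrightarrow> 0) vertices"
  unfolding tendsto_0_uniformly_along
proof (intro allI impI)
  fix e :: real assume e: "0 < e"
  from h[unfolded tendsto_0_uniformly_along, rule_format, OF half_gt_zero[OF e]]
  show "\<forall>\<^sub>F n in sequentially. \<forall>i\<in>{1..n}. \<bar>case (n, i) of (n, i) \<Rightarrow>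
      vertex_avg n (\<lambda>k. adj (E n) i k * h (n, k, i))\<bar> < e"
  proof eventually_elim
    case (elim n)
    have "\<bar>vertex_avg n (\<lambda>k. adj (E n) i k * h (n, k, i))\<bar> \<le> e / 2" if i: "i \<in> {1..n}" for i
    proof (rule abs_vertex_avg_le)
      fix k assume k: "k \<in> {1..n}"
      have "\<not> E n i i" using E[of n] i unfolding simple_graph_on_def by auto
      then show "\<bar>adj (E n) i k * h (n, k, i)\<bar> \<le> e / 2"
        using elim i k e by (cases "k = i") (auto simp: adj_def intro: less_imp_le)
    qed (use e in auto)
    then show ?case using e by fastforce
  qed
qed

text \<open>
  No randomness is left here: the bias converges as soon as three kinds of neighbour averages and
  the codegrees have the expected limits uniformly over vertices. The averages with \<open>\<phi> = 1\<close> give the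
  degrees. Replacing codegrees by codensities and then averaging with \<open>\<phi> x y = codensity y x\<close> gives the
  triangle counts \<open>\<tau>\<close>. Replacing triangle counts by the triangle density and then averaging with that
  density gives the neighbour averages \<open>u\<close> of the triangle counts. The degree density is bounded away
  from \<open>0\<close> by compactness, so \<open>u / d\<close> converges uniformly, and what remains is a Riemann sum.
\<close>

lemma bias_of_convergent_graphs:
  fixes E :: "nat \<Rightarrow> nat \<Rightarrow> nat \<Rightarrow> bool"
  assumes simple: "\<And>n. 0 < n \<Longrightarrow> simple_graph_on {1..n} (E n)"
    and pos: "\<And>x. x \<in> {0..1} \<Longrightarrow> 0 < degree_density \<kappa> x"
    and avg: "\<And>\<phi>. \<phi> \<in> {\<lambda>_ _. 1, \<lambda>x y. codensity y x, \<lambda>_ y. triangle_density \<kappa> y} \<Longrightarrow>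
      ((\<lambda>(n, i). vertex_avg n (\<lambda>j. adj (E n) i j * \<phi> (real i / real n) (real j / real n))
        - integral {0..1} (\<lambda>y. \<kappa> (real i / real n) y * \<phi> (real i / real n) y)) \<longlongrightarrow> 0) vertices"
    and codeg: "((\<lambda>(n, k, i). vertex_avg n (\<lambda>j. adj (E n) k j * adj (E n) j i)
        - codensity (real k / real n) (real i / real n)) \<longlongrightarrow> 0)
        (uniformly_along (\<lambda>n. {(k, i). k \<in> {1..n} \<and> i \<in> {1..n} \<and> k \<noteq> i}))"
  shows "(\<lambda>n. triangle_bias n (E n) / real n ^ 2) \<longlonglongrightarrow> triangle_chi \<kappa>"
proof -
  define \<tau> where "\<tau> n i = real (triangle_count n (E n) i) / real n ^ 2" for n i
  define u where "u n i = vertex_avg n (\<lambda>j. adj (E n) i j * \<tau> n j)" for n i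
  define d where "d n i = vertex_degree n (E n) i / real n" for n i
  let ?x = "\<lambda>n i. real i / real n"
  have x: "?x n i \<in> {0..1}" if "i \<in> {1..n}" for n i
    using that by auto
  have all: "eventually P vertices" if "\<And>n i. i \<in> {1..n} \<Longrightarrow> P (n, i)" for P
    using that by (simp add: eventually_uniformly_along)
  have d: "((\<lambda>(n, i). d n i - degree_density \<kappa> (?x n i)) \<longlongrightarrow> 0) vertices"
  proof -
    have eq: "eventually (\<lambda>p. (case p of (n, i) \<Rightarrow>
        vertex_avg n (\<lambda>j. adj (E n) i j * 1) - integral {0..1} (\<lambda>y. \<kappa> (?x n i) y * 1))
        = (case p of (n, i) \<Rightarrow> d n i - degree_density \<kappa> (?x n i))) vertices"
      by (rule all) (simp add: d_def vertex_avg_def vertex_degree_def degree_density_eq)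
    show ?thesis using avg[of "\<lambda>_ _. 1"] tendsto_cong[OF eq] by simp
  qed
  have \<tau>: "((\<lambda>(n, i). \<tau> n i - triangle_density \<kappa> (?x n i)) \<longlongrightarrow> 0) vertices"
  proof -
    have lim: "((\<lambda>p. 1 / 2 * ((case p of (n, i) \<Rightarrow> vertex_avg n (\<lambda>k. adj (E n) i k *
          (case (n, k, i) of (n, k, i) \<Rightarrow> vertex_avg n (\<lambda>j. adj (E n) k j * adj (E n) j i)
            - codensity (?x n k) (?x n i))))
        + (case p of (n, i) \<Rightarrow> vertex_avg n (\<lambda>k. adj (E n) i k * codensity (?x n k) (?x n i))
            - integral {0..1} (\<lambda>y. \<kappa> (?x n i) y * codensity y (?x n i))))) \<longlongrightarrow> 0) vertices"
      using neighbour_average_tendsto_0[OF simple codeg] avg[of "\<lambda>x y. codensity y x"]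
      by (intro tendsto_mult_right_zero tendsto_add_zero) simp_all
    have "\<tau> n i - triangle_density \<kappa> (?x n i) = 1 / 2 * (vertex_avg n (\<lambda>k. adj (E n) i k *
          (vertex_avg n (\<lambda>j. adj (E n) k j * adj (E n) j i) - codensity (?x n k) (?x n i)))
        + (vertex_avg n (\<lambda>k. adj (E n) i k * codensity (?x n k) (?x n i))
            - integral {0..1} (\<lambda>y. \<kappa> (?x n i) y * codensity y (?x n i))))"
      if i: "i \<in> {1..n}" for n i
    proof -
      have n: "0 < n" using i by simp
      have "\<tau> n i = 1 / 2 * vertex_avg n
          (\<lambda>k. adj (E n) i k * vertex_avg n (\<lambda>j. adj (E n) k j * adj (E n) j i))"
        unfolding \<tau>_def triangle_count_eq[OF simple[OF n] i]
        by (simp add: vertex_avg_def power2_eq_square flip: sum_divide_distrib)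
      moreover have "triangle_density \<kappa> (?x n i)
          = 1 / 2 * integral {0..1} (\<lambda>y. \<kappa> (?x n i) y * codensity y (?x n i))"
        by (rule triangle_density_eq[OF x[OF i]])
      ultimately show ?thesis by (simp add: right_diff_distrib vertex_avg_diff)
    qed
    then have eq: "eventually (\<lambda>p. 1 / 2 * ((case p of (n, i) \<Rightarrow> vertex_avg n (\<lambda>k. adj (E n) i k *
          (case (n, k, i) of (n, k, i) \<Rightarrow> vertex_avg n (\<lambda>j. adj (E n) k j * adj (E n) j i)
            - codensity (?x n k) (?x n i))))
        + (case p of (n, i) \<Rightarrow> vertex_avg n (\<lambda>k. adj (E n) i k * codensity (?x n k) (?x n i))
            - integral {0..1} (\<lambda>y. \<kappa> (?x n i) y * codensity y (?x n i))))
        = (case p of (n, i) \<Rightarrow> \<tau> n i - triangle_density \<kappa> (?x n i))) vertices"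
      by (intro all) simp
    from lim show ?thesis using tendsto_cong[OF eq] by simp
  qed
  have u: "((\<lambda>(n, i). u n i - neighbour_triangle_density (?x n i)) \<longlongrightarrow> 0) vertices"
  proof -
    have "((\<lambda>(n, k, i). \<tau> n k - triangle_density \<kappa> (?x n k)) \<longlongrightarrow> 0)
        (uniformly_along (\<lambda>n. {(k, i). k \<in> {1..n} \<and> i \<in> {1..n} \<and> k \<noteq> i}))"
      using \<tau> unfolding tendsto_0_uniformly_along by (fastforce elim: eventually_mono)
    from tendsto_add_zero[OF neighbour_average_tendsto_0[OF simple this]
        avg[of "\<lambda>_ y. triangle_density \<kappa> y"]]
    have "((\<lambda>p. (case p of (n, i) \<Rightarrow> vertex_avg n (\<lambda>k. adj (E n) i k *
          (case (n, k, i) of (n, k, i) \<Rightarrow> \<tau> n k - triangle_density \<kappa> (?x n k))))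
        + (case p of (n, i) \<Rightarrow> vertex_avg n (\<lambda>k. adj (E n) i k * triangle_density \<kappa> (?x n k))
            - integral {0..1} (\<lambda>y. \<kappa> (?x n i) y * triangle_density \<kappa> y))) \<longlongrightarrow> 0) vertices"
      by simp
    then show ?thesis
      by (rule back_subst[of "\<lambda>f. (f \<longlongrightarrow> 0) vertices"])
        (auto simp: fun_eq_iff u_def neighbour_triangle_density_def right_diff_distrib vertex_avg_diff)
  qed
  \<comment> \<open>Compactness turns positivity of the degree density into a uniform lower bound.\<close>
  obtain \<delta> where \<delta>: "0 < \<delta>" "\<And>x. x \<in> {0..1} \<Longrightarrow> \<delta> \<le> degree_density \<kappa> x"
  proof -
    obtain x0 where "x0 \<in> {0..1}" "\<forall>x\<in>{0..1}. degree_density \<kappa> x0 \<le> degree_density \<kappa> x"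
      using continuous_attains_inf[OF compact_Icc _ degree_density_cont] by auto
    then show ?thesis using that[of "degree_density \<kappa> x0"] pos by blast
  qed
  have quot: "((\<lambda>p. (case p of (n, i) \<Rightarrow> u n i) / (case p of (n, i) \<Rightarrow> d n i)
      - (case p of (n, i) \<Rightarrow> neighbour_triangle_density (?x n i))
        / (case p of (n, i) \<Rightarrow> degree_density \<kappa> (?x n i))) \<longlongrightarrow> 0) vertices"
  proof (rule tendsto_0_diff_quotient[OF _ _ _ _ \<delta>(1)])
    show "eventually (\<lambda>p. \<bar>case p of (n, i) \<Rightarrow> neighbour_triangle_density (?x n i)\<bar> \<le> 1) vertices"
      by (rule all) (use neighbour_triangle_density_in_unit[OF x] in simp)
    show "eventually (\<lambda>p. \<delta> \<le> (case p of (n, i) \<Rightarrow> degree_density \<kappa> (?x n i))) vertices"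
      by (rule all) (use \<delta>(2)[OF x] in simp)
  qed (use u d in \<open>simp_all add: case_prod_unfold\<close>)
  define g where "g x = neighbour_triangle_density x / degree_density \<kappa> x - triangle_density \<kappa> x" for x
  \<comment> \<open>Degrees within \<open>\<delta>\<close> of their limit are nonzero, so the exceptional branch of the bias for
    isolated vertices is eventually never taken.\<close>
  have "eventually (\<lambda>(n, i). \<bar>d n i - degree_density \<kappa> (?x n i)\<bar> < \<delta>) vertices"
    using tendstoD[OF d \<delta>(1)] by (simp add: case_prod_unfold)
  moreover have "eventually (\<lambda>(n, i). i \<in> {1..n}) vertices" by (rule all) simp
  ultimately have bias: "eventually (\<lambda>(n, i). vertex_triangle_bias n (E n) i / real n ^ 2
      = u n i / d n i - \<tau> n i) vertices"
  proof eventually_elim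
    case (elim p)
    obtain n i where p: "p = (n, i)" by (cases p)
    have "0 < d n i" using elim \<delta>(2)[OF x[of i n]] unfolding p by auto
    then have deg: "vertex_degree n (E n) i \<noteq> 0" by (auto simp: d_def)
    have n: "n \<noteq> 0" using elim unfolding p by auto
    have "u n i = (\<Sum>j\<in>{1..n}. adj (E n) i j * real (triangle_count n (E n) j)) / real n ^ 3"
      by (simp add: u_def vertex_avg_def \<tau>_def power2_eq_square power3_eq_cube mult_ac
          flip: sum_divide_distrib)
    then show ?case
      unfolding p using deg n
      by (simp add: vertex_triangle_bias_def d_def \<tau>_def diff_divide_distrib power2_eq_square
          power3_eq_cube)
  qed
  have "((\<lambda>(n, i). vertex_triangle_bias n (E n) i / real n ^ 2 - g (?x n i)) \<longlongrightarrow> 0) vertices"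
  proof (rule Lim_transform_eventually[OF tendsto_diff[OF quot \<tau>, unfolded diff_zero]])
    show "eventually (\<lambda>p. (case p of (n, i) \<Rightarrow> u n i) / (case p of (n, i) \<Rightarrow> d n i)
      - (case p of (n, i) \<Rightarrow> neighbour_triangle_density (?x n i))
        / (case p of (n, i) \<Rightarrow> degree_density \<kappa> (?x n i))
      - (case p of (n, i) \<Rightarrow> \<tau> n i - triangle_density \<kappa> (?x n i))
      = (case p of (n, i) \<Rightarrow> vertex_triangle_bias n (E n) i / real n ^ 2 - g (?x n i))) vertices"
      using bias by eventually_elim (auto simp: g_def)
  qed
  from vertex_avg_tendsto_0[OF this]
  have lim: "(\<lambda>n. vertex_avg n (\<lambda>i. vertex_triangle_bias n (E n) i / real n ^ 2)
      - vertex_avg n (\<lambda>i. g (?x n i))) \<longlonglongrightarrow> 0"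
    by (simp add: vertex_avg_diff)
  have g: "continuous_on {0..1} g"
    unfolding g_def using pos by (intro continuous_intros neighbour_triangle_density_cont
        degree_density_cont triangle_density_cont) (auto simp: less_le)
  have "(\<lambda>n. vertex_avg n (\<lambda>i. g (?x n i))) \<longlonglongrightarrow> integral {0..1} g"
  proof (rule tendstoI)
    fix e :: real assume "0 < e"
    \<comment> \<open>The uniform statement with a one-point parameter space.\<close>
    moreover have "continuous_on ({0::real} \<times> {0..1}) (\<lambda>(_, y). g y)"
      unfolding case_prod_unfold by (intro continuous_on_compose2[OF g] continuous_intros) auto
    ultimately have "\<forall>\<^sub>F n in sequentially. \<forall>p\<in>{0::real}.
        \<bar>vertex_avg n (\<lambda>j. g (?x n j)) - integral {0..1} g\<bar> < e"
      by (intro riemann_sums_uniform) auto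
    then show "\<forall>\<^sub>F n in sequentially. dist (vertex_avg n (\<lambda>i. g (?x n i))) (integral {0..1} g) < e"
      by (simp add: dist_real_def)
  qed
  from tendsto_add[OF lim this]
  have "(\<lambda>n. vertex_avg n (\<lambda>i. vertex_triangle_bias n (E n) i / real n ^ 2)) \<longlonglongrightarrow> integral {0..1} g"
    by simp
  moreover have "vertex_avg n (\<lambda>i. vertex_triangle_bias n (E n) i / real n ^ 2)
      = triangle_bias n (E n) / real n ^ 2" for n
    by (simp add: vertex_avg_def triangle_bias_def flip: sum_divide_distrib)
  ultimately show ?thesis
    using triangle_chi_eq[OF pos] by (simp add: g_def[abs_def])
qed

end

section \<open>Edges of the random graphs\<close>

text \<open>
  Edge indicators are independent when indexed by increasing pairs, so every unordered pair is
  encoded by its increasing ordering.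
\<close>

definition edge :: "nat \<Rightarrow> nat \<Rightarrow> nat \<times> nat" where
  "edge i j = (min i j, max i j)"

lemma edge_eq_iff: "edge i j = edge k l \<longleftrightarrow> i = k \<and> j = l \<or> i = l \<and> j = k"
  by (auto simp: edge_def min_def max_def split: if_splits)

locale graphon_random_graphs = continuous_graphon \<kappa> + prob_space M
  for \<kappa> and M :: "'a measure" +
  fixes G :: "nat \<Rightarrow> 'a \<Rightarrow> nat \<Rightarrow> nat \<Rightarrow> bool"
  assumes graphs: "\<And>n. n \<ge> 1 \<Longrightarrow> graphon_random_graph M n \<kappa> (G n)"
begin

definition has_edge :: "nat \<Rightarrow> nat \<times> nat \<Rightarrow> 'a \<Rightarrow> bool" where
  "has_edge n = (\<lambda>(i, j) \<omega>. G n \<omega> i j)"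

definition edges :: "nat \<Rightarrow> (nat \<times> nat) set" where
  "edges n = {(i, j). 1 \<le> i \<and> i < j \<and> j \<le> n}"

lemma simple: "0 < n \<Longrightarrow> \<omega> \<in> space M \<Longrightarrow> simple_graph_on {1..n} (G n \<omega>)"
  using graphs[of n] unfolding graphon_random_graph_def by auto

lemma indep_edges: "0 < n \<Longrightarrow> indep_vars (\<lambda>_. count_space UNIV) (has_edge n) (edges n)"
  using graphs[of n] unfolding graphon_random_graph_def has_edge_def edges_def by auto

lemma edge_in_edges: "i \<in> {1..n} \<Longrightarrow> j \<in> {1..n} \<Longrightarrow> i \<noteq> j \<Longrightarrow> edge i j \<in> edges n"
  by (auto simp: edge_def edges_def min_def max_def)

lemma adj_eq_has_edge:
  assumes "0 < n" "\<omega> \<in> space M"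
  shows "adj (G n \<omega>) i j = of_bool (has_edge n (edge i j) \<omega>)"
proof -
  have "G n \<omega> i j \<longleftrightarrow> G n \<omega> j i"
    using simple[OF assms] unfolding simple_graph_on_def by blast
  then show ?thesis by (simp add: adj_def has_edge_def edge_def min_def max_def)
qed

lemma prob_has_edge:
  assumes i: "i \<in> {1..n}" and j: "j \<in> {1..n}" and ne: "i \<noteq> j"
  shows "prob {\<omega> \<in> space M. has_edge n (edge i j) \<omega>} = \<kappa> (real i / real n) (real j / real n)"
proof -
  have ends: "real i / real n \<in> {0..1}" "real j / real n \<in> {0..1}" using i j by auto
  have p: "prob {\<omega> \<in> space M. G n \<omega> a b} = \<kappa> (real a / real n) (real b / real n)"
    if "1 \<le> a" "a < b" "b \<le> n" for a b
    using graphs[of n] that unfolding graphon_random_graph_def by auto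
  show ?thesis
    using p[of i j] p[of j i] i j ne graphon_sym[OF ends]
    by (auto simp: has_edge_def edge_def min_def max_def)
qed

text \<open>
  For fixed \<open>i\<close> the edges \<open>{i, j}\<close> are distinct for distinct \<open>j\<close>, so the average is one of independent
  terms, up to the vertex \<open>j = i\<close>. Its mean is a Riemann sum for the integral.
\<close>

lemma averages_over_neighbours:
  assumes \<phi>: "continuous_on unit_square (\<lambda>(x, y). \<phi> x y)"
    and \<phi>01: "\<And>x y. x \<in> {0..1} \<Longrightarrow> y \<in> {0..1} \<Longrightarrow> \<phi> x y \<in> {0..1}"
  shows "AE \<omega> in M. ((\<lambda>(n, i).
      vertex_avg n (\<lambda>j. adj (G n \<omega>) i j * \<phi> (real i / real n) (real j / real n))
        - integral {0..1} (\<lambda>y. \<kappa> (real i / real n) y * \<phi> (real i / real n) y)) \<longlongrightarrow> 0) vertices"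
proof -
  let ?x = "\<lambda>n i. real i / real n"
  have x: "?x n i \<in> {0..1}" if "i \<in> {1..n}" for n i using that by auto
  have random: "AE \<omega> in M. ((\<lambda>(n, i). vertex_avg n (\<lambda>j. adj (G n \<omega>) i j * \<phi> (?x n i) (?x n j))
      - vertex_avg n (\<lambda>j. \<kappa> (?x n i) (?x n j) * \<phi> (?x n i) (?x n j))) \<longlongrightarrow> 0) vertices"
  proof (rule averages_of_disjoint_products[where B = has_edge and E = edges
        and J = "\<lambda>n i. {1..n} - {i}" and K = "\<lambda>n i j. {edge i j}"
        and c = "\<lambda>n i j. \<phi> (?x n i) (?x n j)"])
    fix n i :: nat assume i: "i \<in> {1..n}"
    have n: "0 < n" using i by simp
    show "{1..n} - {i} \<subseteq> {1..n} \<and> card ({1..n} - ({1..n} - {i})) \<le> 2"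
      using i by (simp add: double_diff)
    show "disjoint_family_on (\<lambda>j. {edge i j}) ({1..n} - {i})"
      by (auto simp: disjoint_family_on_def edge_eq_iff)
    fix j
    { assume j: "j \<in> {1..n} - {i}"
      show "finite {edge i j} \<and> {edge i j} \<subseteq> edges n"
        using edge_in_edges i j by auto
      show "\<phi> (?x n i) (?x n j) \<in> {0..1}" using \<phi>01 x i j by blast
      show "\<kappa> (?x n i) (?x n j) * \<phi> (?x n i) (?x n j) = \<phi> (?x n i) (?x n j) *
          (\<Prod>e\<in>{edge i j}. prob {\<omega> \<in> space M. has_edge n e \<omega>})"
        using prob_has_edge[OF i, of j] j by auto
      show "adj (G n \<omega>) i j * \<phi> (?x n i) (?x n j) = \<phi> (?x n i) (?x n j) *
          (\<Prod>e\<in>{edge i j}. of_bool (has_edge n e \<omega>))" if "\<omega> \<in> space M" for \<omega>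
        using adj_eq_has_edge[OF n that] by simp }
    { assume j: "j \<in> {1..n}"
      have \<kappa>: "\<kappa> (?x n i) (?x n j) \<in> {0..1}" "\<phi> (?x n i) (?x n j) \<in> {0..1}"
        using graphon_in_unit \<phi>01 x i j by blast+
      then show "\<kappa> (?x n i) (?x n j) * \<phi> (?x n i) (?x n j) \<in> {0..1}"
        by (auto intro: mult_le_one)
      show "adj (G n \<omega>) i j * \<phi> (?x n i) (?x n j) \<in> {0..1}" for \<omega>
        using \<kappa> by (auto simp: adj_def) }
  qed (use indep_edges in \<open>auto simp: power2_eq_square\<close>)
  have riemann: "((\<lambda>(n, i). vertex_avg n (\<lambda>j. \<kappa> (?x n i) (?x n j) * \<phi> (?x n i) (?x n j))
      - integral {0..1} (\<lambda>y. \<kappa> (?x n i) y * \<phi> (?x n i) y)) \<longlongrightarrow> 0) vertices"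
    unfolding tendsto_0_uniformly_along
  proof (intro allI impI)
    fix e :: real assume e: "0 < e"
    have "continuous_on unit_square (\<lambda>(x, y). \<kappa> x y * \<phi> x y)"
      using continuous_on_mult[OF cont \<phi>] by (simp add: case_prod_unfold)
    from riemann_sums_uniform[OF compact_Icc this e]
    show "\<forall>\<^sub>F n in sequentially. \<forall>i\<in>{1..n}. \<bar>case (n, i) of (n, i) \<Rightarrow>
        vertex_avg n (\<lambda>j. \<kappa> (?x n i) (?x n j) * \<phi> (?x n i) (?x n j))
        - integral {0..1} (\<lambda>y. \<kappa> (?x n i) y * \<phi> (?x n i) y)\<bar> < e"
      by eventually_elim (use x in \<open>simp only: prod.case, blast\<close>)
  qed
  from random show ?thesis
  proof eventually_elim
    case (elim \<omega>)
    from tendsto_add_zero[OF this riemann] show ?case by (simp add: case_prod_unfold)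
  qed
qed

text \<open>
  For fixed \<open>k \<noteq> i\<close> the products of the edges \<open>{k, j}\<close> and \<open>{j, i}\<close> involve disjoint pairs of edges for
  distinct \<open>j\<close>, so they are independent even though the codegree is quadratic in the edge indicators. The
  exceptional vertices are \<open>j = k\<close> and \<open>j = i\<close>.
\<close>

lemma codegrees:
  "AE \<omega> in M. ((\<lambda>(n, k, i). vertex_avg n (\<lambda>j. adj (G n \<omega>) k j * adj (G n \<omega>) j i)
      - codensity (real k / real n) (real i / real n)) \<longlongrightarrow> 0)
    (uniformly_along (\<lambda>n. {(k, i). k \<in> {1..n} \<and> i \<in> {1..n} \<and> k \<noteq> i}))"
    (is "AE \<omega> in M. (_ \<longlongrightarrow> 0) (uniformly_along ?S)")
proof -
  let ?x = "\<lambda>n i. real i / real n"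
  have x: "?x n i \<in> {0..1}" if "i \<in> {1..n}" for n i using that by auto
  have random: "AE \<omega> in M. ((\<lambda>(n, s).
        vertex_avg n (\<lambda>j. adj (G n \<omega>) (fst s) j * adj (G n \<omega>) j (snd s))
      - vertex_avg n (\<lambda>j. \<kappa> (?x n (fst s)) (?x n j) * \<kappa> (?x n j) (?x n (snd s)))) \<longlongrightarrow> 0)
    (uniformly_along ?S)"
  proof (rule averages_of_disjoint_products[where B = has_edge and E = edges
        and J = "\<lambda>n s. {1..n} - {fst s, snd s}" and K = "\<lambda>n s j. {edge (fst s) j, edge j (snd s)}"
        and c = "\<lambda>_ _ _. 1"])
    fix n
    have "?S n \<subseteq> {1..n} \<times> {1..n}" by auto
    from finite_subset[OF this] card_mono[OF _ this]
    show "finite (?S n) \<and> card (?S n) \<le> n\<^sup>2" by (simp add: power2_eq_square)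
    fix s assume "s \<in> ?S n"
    then obtain k i where s: "s = (k, i)" and k: "k \<in> {1..n}" and i: "i \<in> {1..n}" and ki: "k \<noteq> i"
      by auto
    have n: "0 < n" using i by simp
    show "{1..n} - {fst s, snd s} \<subseteq> {1..n} \<and> card ({1..n} - ({1..n} - {fst s, snd s})) \<le> 2"
      using i k ki by (simp add: double_diff s)
    show "disjoint_family_on (\<lambda>j. {edge (fst s) j, edge j (snd s)}) ({1..n} - {fst s, snd s})"
      using ki by (auto simp: disjoint_family_on_def edge_eq_iff s)
    fix j
    { assume j: "j \<in> {1..n} - {fst s, snd s}"
      then have ne: "edge k j \<noteq> edge j i" using ki by (auto simp: edge_eq_iff s)
      show "finite {edge (fst s) j, edge j (snd s)} \<and> {edge (fst s) j, edge j (snd s)} \<subseteq> edges n"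
        using edge_in_edges[of k n j] edge_in_edges[of j n i] i j k by (auto simp: s)
      show "\<kappa> (?x n (fst s)) (?x n j) * \<kappa> (?x n j) (?x n (snd s)) = 1 *
          (\<Prod>e\<in>{edge (fst s) j, edge j (snd s)}. prob {\<omega> \<in> space M. has_edge n e \<omega>})"
        using prob_has_edge[OF k, of j] prob_has_edge[OF _ i, of j] j ne by (auto simp: s)
      show "adj (G n \<omega>) (fst s) j * adj (G n \<omega>) j (snd s) = 1 *
          (\<Prod>e\<in>{edge (fst s) j, edge j (snd s)}. of_bool (has_edge n e \<omega>))"
        if "\<omega> \<in> space M" for \<omega>
        using adj_eq_has_edge[OF n that] ne by (simp add: s) }
    { assume j: "j \<in> {1..n}"
      have "\<kappa> (?x n k) (?x n j) \<in> {0..1}" "\<kappa> (?x n j) (?x n i) \<in> {0..1}"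
        using graphon_in_unit x i j k by blast+
      then show "\<kappa> (?x n (fst s)) (?x n j) * \<kappa> (?x n j) (?x n (snd s)) \<in> {0..1}"
        by (auto intro: mult_le_one simp: s)
      show "adj (G n \<omega>) (fst s) j * adj (G n \<omega>) j (snd s) \<in> {0..1}" for \<omega>
        by (auto simp: adj_def) }
  qed (use indep_edges in auto)
  have riemann: "((\<lambda>(n, s). vertex_avg n (\<lambda>j. \<kappa> (?x n (fst s)) (?x n j) * \<kappa> (?x n j) (?x n (snd s)))
      - codensity (?x n (fst s)) (?x n (snd s))) \<longlongrightarrow> 0) (uniformly_along ?S)"
    unfolding tendsto_0_uniformly_along
  proof (intro allI impI)
    fix e :: real assume e: "0 < e"
    have "compact unit_square" by (intro compact_Times) auto
    moreover have "continuous_on (unit_square \<times> {0..1}) (\<lambda>(p, z). \<kappa> (fst p) z * \<kappa> z (snd p))"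
      unfolding case_prod_unfold by (intro continuous_intros) auto
    ultimately have "\<forall>\<^sub>F n in sequentially. \<forall>p\<in>unit_square.
        \<bar>vertex_avg n (\<lambda>j. \<kappa> (fst p) (?x n j) * \<kappa> (?x n j) (snd p))
          - integral {0..1} (\<lambda>z. \<kappa> (fst p) z * \<kappa> z (snd p))\<bar> < e"
      using e by (rule riemann_sums_uniform)
    then show "\<forall>\<^sub>F n in sequentially. \<forall>s\<in>?S n. \<bar>case (n, s) of (n, s) \<Rightarrow>
        vertex_avg n (\<lambda>j. \<kappa> (?x n (fst s)) (?x n j) * \<kappa> (?x n j) (?x n (snd s)))
        - codensity (?x n (fst s)) (?x n (snd s))\<bar> < e"
    proof eventually_elim
      case (elim n)
      show ?case
      proof
        fix s assume "s \<in> ?S n"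
        then have "(?x n (fst s), ?x n (snd s)) \<in> unit_square"
          using x[of "fst s" n] x[of "snd s" n] by auto
        from bspec[OF elim this] show "\<bar>case (n, s) of (n, s) \<Rightarrow>
            vertex_avg n (\<lambda>j. \<kappa> (?x n (fst s)) (?x n j) * \<kappa> (?x n j) (?x n (snd s)))
            - codensity (?x n (fst s)) (?x n (snd s))\<bar> < e"
          unfolding codensity_def by simp
      qed
    qed
  qed
  from random show ?thesis
  proof eventually_elim
    case (elim \<omega>)
    from tendsto_add_zero[OF this riemann] show ?case by (simp add: case_prod_unfold)
  qed
qed

lemma triangle_bias_limit:
  assumes pos: "\<And>x. x \<in> {0..1} \<Longrightarrow> 0 < degree_density \<kappa> x"
  shows "AE \<omega> in M. (\<lambda>n. triangle_bias n (G n \<omega>) / real n ^ 2) \<longlonglongrightarrow> triangle_chi \<kappa>"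
proof -
  have "AE \<omega> in M. ((\<lambda>(n, i). vertex_avg n (\<lambda>j. adj (G n \<omega>) i j * 1)
      - integral {0..1} (\<lambda>y. \<kappa> (real i / real n) y * 1)) \<longlongrightarrow> 0) vertices"
    by (rule averages_over_neighbours[of "\<lambda>_ _. 1"]) auto
  moreover have "AE \<omega> in M. ((\<lambda>(n, i).
      vertex_avg n (\<lambda>j. adj (G n \<omega>) i j * codensity (real j / real n) (real i / real n))
      - integral {0..1} (\<lambda>y. \<kappa> (real i / real n) y * codensity y (real i / real n))) \<longlongrightarrow> 0) vertices"
    using codensity_in_unit
    by (intro averages_over_neighbours[of "\<lambda>x y. codensity y x"], unfold case_prod_unfold)
      (intro continuous_intros, auto)
  moreover have "AE \<omega> in M. ((\<lambda>(n, i).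
      vertex_avg n (\<lambda>j. adj (G n \<omega>) i j * triangle_density \<kappa> (real j / real n))
      - integral {0..1} (\<lambda>y. \<kappa> (real i / real n) y * triangle_density \<kappa> y)) \<longlongrightarrow> 0) vertices"
    using triangle_density_in_unit
    by (intro averages_over_neighbours[of "\<lambda>_ y. triangle_density \<kappa> y"], unfold case_prod_unfold)
      (intro continuous_intros, auto)
  ultimately show ?thesis using codegrees AE_space
  proof eventually_elim
    case (elim \<omega>)
    show ?case
      using simple[OF _ elim(5)] elim(1-4) pos by (intro bias_of_convergent_graphs) auto
  qed
qed

end

theorem theorem6:
  fixes \<kappa> :: "real \<Rightarrow> real \<Rightarrow> real"
    and M :: "'a measure"
    and G :: "nat \<Rightarrow> 'a \<Rightarrow> nat \<Rightarrow> nat \<Rightarrow> bool"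
  assumes "graphon \<kappa>"
    and "continuous_on ({0..1} \<times> {0..1}) (\<lambda>(x, y). \<kappa> x y)"
    and "\<forall>x\<in>{0..1}. (LINT y:{0..1}|lborel. \<kappa> x y) > 0"
    and "prob_space M"
    and "\<And>n. n \<ge> 1 \<Longrightarrow> graphon_random_graph M n \<kappa> (G n)"
  shows "AE \<omega> in M.
    (\<lambda>n. triangle_bias n (G n \<omega>) / real n ^ 2) \<longlonglongrightarrow> triangle_chi \<kappa>"
proof -
  interpret continuous_graphon \<kappa> using assms(1,2) by unfold_locales
  interpret prob_space M by fact
  interpret graphon_random_graphs \<kappa> M G using assms(5) by unfold_locales
  show ?thesis using assms(3) by (intro triangle_bias_limit) (simp add: degree_density_def)
qed

end
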